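(* Let $p\in(1,\infty)$, let $(X,\mathcal{X},\mu,\mathcal{E}_p,\mathcal{F}_p,\Gamma_p)$ be a $p$-Dirichlet structure and let $n\in\mathbb{N}$. For every Lipschitz function $g:\mathbb{R}^n\to\mathbb{R}$ with $g(0)=0$ and every $f=(f_1,\dots,f_n)\in\mathcal{F}_p^n$ we have $g\circ f\in\mathcal{F}_p$ and $$\Gamma_p\langle g\circ f\rangle\le\big(1\vee n^{(p-2)/2}\big)(\mathrm{Lip}_a[g]\circ f)^p\cdot\sum_{i=1}^n\Gamma_p\langle f_i\rangle.$$
   Context: For a Lipschitz function $g$ on $\mathbb{R}^n$ (Euclidean distance), $\mathrm{LIP}[g|_E]$ is the smallest Lipschitz constant of $g$ on $E$ and $\mathrm{Lip}_a[g](y)=\lim_{r\to0}\mathrm{LIP}[g|_{B(y,r)}]$ (a Borel function of $y$). $\mathrm{Lip}(\mathbb{R})$ is the space of real-valued Lipschitz functions on $\mathbb{R}$. Inequalities between measures are setwise, and $u\cdot\nu$ (or $u\,\nu$) is the measure with density $u$ with respect to $\nu$. $a\vee b=\max(a,b)$. A $p$-Dirichlet structure $(X,\mathcal{X},\mu,\mathcal{E}_p,\mathcal{F}_p,\Gamma_p)$ satisfies: (1) $(X,\mathcal{X},\mu)$ is a probability space and $\mathcal{F}_p$ is a linear subspace of $L^p(X,\mu)$ with $\mathbf{1}_X\in\mathcal{F}_p$. (2) $\mathcal{E}_p:\mathcal{F}_p\to[0,\infty)$, $\mathcal{E}_p^{1/p}$ is a seminorm on $\mathcal{F}_p$, and $\mathcal{F}_p$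 is a Banach space with norm $\|f\|_{\mathcal{F}_p}=(\|f\|_{L^p}^p+\mathcal{E}_p(f))^{1/p}$. (3) For each $f\in\mathcal{F}_p$ there is a finite nonnegative measure $\Gamma_p\langle f\rangle$ on $(X,\mathcal{X})$ with $\Gamma_p\langle f\rangle(X)=\mathcal{E}_p(f)$ and $\Gamma_p\langle\lambda f\rangle=|\lambda|^p\Gamma_p\langle f\rangle$ for all $\lambda\in\mathbb{R}$. (4) $\Gamma_p\langle f\rangle\ll\mu$ for all $f\in\mathcal{F}_p$. (5) $\Gamma_p\langle f+g\rangle(A)^{1/p}\le\Gamma_p\langle f\rangle(A)^{1/p}+\Gamma_p\langle g\rangle(A)^{1/p}$ for all $f,g\in\mathcal{F}_p$, $A\in\mathcal{X}$. (6) For all $f\in\mathcal{F}_p$ and $g\in\mathrm{Lip}(\mathbb{R})$ with $g(0)=0$: $g\circ f\in\mathcal{F}_p$ and $\Gamma_p\langle g\circ f\rangle\le(\mathrm{Lip}_a[g]\circ f)^p\,\Gamma_p\langle f\rangle$. (7) If $f\in\mathcal{F}_p$, $A\in\mathcal{X}$ and $f|_A$ equals a constant $\mu$-a.e., then $\Gamma_p\langle f\rangle(A)=0$. (8) If $f\in L^p(X,\mu)$, $f_i\in\mathcal{F}_p$, $f_i\to f$ in $L^p$ and $\sup_i\mathcal{E}_p(f_i)<\infty$, then $f\in\mathcal{F}_p$ and $\Gamma_p\langle f\rangle(A)\le\liminf_i\Gamma_p\langle f_i\rangle(A)$ for every $A\in\mathcal{X}$. *)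

theory Defs
  imports "HOL-Probability.Probability"
begin

definition LIP :: "('b::metric_space \<Rightarrow> real) \<Rightarrow> 'b set \<Rightarrow> real" where
  "LIP g S = Inf {L. L-lipschitz_on S g}"

definition Lip_a :: "('b::metric_space \<Rightarrow> real) \<Rightarrow> 'b \<Rightarrow> real" where
  "Lip_a g y = Lim (at_right 0) (\<lambda>r. LIP g (ball y r))"

definition Lp_space :: "real \<Rightarrow> 'a measure \<Rightarrow> ('a \<Rightarrow> real) set" where
  "Lp_space p M = {f \<in> borel_measurable M. integrable M (\<lambda>x. \<bar>f x\<bar> powr p)}"

definition Lp_norm :: "real \<Rightarrow> 'a measure \<Rightarrow> ('a \<Rightarrow> real) \<Rightarrow> real" where
  "Lp_norm p M f = (LINT x|M. \<bar>f x\<bar> powr p) powr (1 / p)"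

definition measure_le :: "'a measure \<Rightarrow> 'a measure \<Rightarrow> bool" where
  "measure_le N N' \<longleftrightarrow> sets N = sets N' \<and> (\<forall>A\<in>sets N. emeasure N A \<le> emeasure N' A)"

definition sum_measure :: "'a measure \<Rightarrow> 'i set \<Rightarrow> ('i \<Rightarrow> 'a measure) \<Rightarrow> 'a measure" where
  "sum_measure M I N = measure_of (space M) (sets M) (\<lambda>A. \<Sum>i\<in>I. emeasure (N i) A)"

text \<open>
  Elements of \<open>L\<^sup>p\<close> are represented by functions rather than by almost-everywhere classes.
  The domain \<open>F\<close> is therefore a set of functions closed under almost-everywhere equality,
  and \<open>E\<close> and \<open>\<Gamma>\<close> take equal values on almost everywhere equal functions (assumption
  \<open>AE_class\<close>). Values of \<open>E\<close> and \<open>\<Gamma>\<close> outside \<open>F\<close> are irrelevant. Completeness refers to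
  the norm induced on almost-everywhere classes; that it is a norm there follows from
  the seminorm assumptions on \<open>E\<close>.
\<close>

locale p_dirichlet_structure = prob_space M
  for p :: real
    and M :: "'a measure"
    and E :: "('a \<Rightarrow> real) \<Rightarrow> real"
    and F :: "('a \<Rightarrow> real) set"
    and \<Gamma> :: "('a \<Rightarrow> real) \<Rightarrow> 'a measure" +
  assumes AE_class:
      "\<And>f h. \<lbrakk>f \<in> F; h \<in> borel_measurable M; AE x in M. h x = f x\<rbrakk>
        \<Longrightarrow> h \<in> F \<and> E h = E f \<and> \<Gamma> h = \<Gamma> f"
    and F_subset_Lp: "F \<subseteq> Lp_space p M"
    and F_zero: "(\<lambda>x. 0) \<in> F"
    and F_add: "\<And>f h. \<lbrakk>f \<in> F; h \<in> F\<rbrakk> \<Longrightarrow> (\<lambda>x. f x + h x) \<in> F"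
    and F_scale: "\<And>f c. f \<in> F \<Longrightarrow> (\<lambda>x. c * f x) \<in> F"
    and F_one: "(\<lambda>x. 1) \<in> F"
    and E_nonneg: "\<And>f. f \<in> F \<Longrightarrow> 0 \<le> E f"
    and E_scale: "\<And>f c. f \<in> F \<Longrightarrow> E (\<lambda>x. c * f x) powr (1 / p) = \<bar>c\<bar> * E f powr (1 / p)"
    and E_triangle: "\<And>f h. \<lbrakk>f \<in> F; h \<in> F\<rbrakk> \<Longrightarrow>
      E (\<lambda>x. f x + h x) powr (1 / p) \<le> E f powr (1 / p) + E h powr (1 / p)"
    and F_complete: "\<And>u.
      \<lbrakk>\<And>i::nat. u i \<in> F;
       \<And>e. e > 0 \<Longrightarrow> \<exists>N. \<forall>i\<ge>N. \<forall>j\<ge>N.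
         (Lp_norm p M (\<lambda>x. u i x - u j x) powr p + E (\<lambda>x. u i x - u j x)) powr (1 / p) < e\<rbrakk>
      \<Longrightarrow> \<exists>f\<in>F. (\<lambda>i. (Lp_norm p M (\<lambda>x. u i x - f x) powr p
                        + E (\<lambda>x. u i x - f x)) powr (1 / p)) \<longlonglongrightarrow> 0"
    and \<Gamma>_sets: "\<And>f. f \<in> F \<Longrightarrow> sets (\<Gamma> f) = sets M"
    and \<Gamma>_finite: "\<And>f. f \<in> F \<Longrightarrow> finite_measure (\<Gamma> f)"
    and \<Gamma>_total: "\<And>f. f \<in> F \<Longrightarrow> measure (\<Gamma> f) (space M) = E f"
    and \<Gamma>_scale: "\<And>f c. f \<in> F \<Longrightarrow>
      \<Gamma> (\<lambda>x. c * f x) = scale_measure (ennreal (\<bar>c\<bar> powr p)) (\<Gamma> f)"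
    and \<Gamma>_absolutely_continuous: "\<And>f. f \<in> F \<Longrightarrow> absolutely_continuous M (\<Gamma> f)"
    and \<Gamma>_triangle: "\<And>f h A. \<lbrakk>f \<in> F; h \<in> F; A \<in> sets M\<rbrakk> \<Longrightarrow>
      measure (\<Gamma> (\<lambda>x. f x + h x)) A powr (1 / p)
        \<le> measure (\<Gamma> f) A powr (1 / p) + measure (\<Gamma> h) A powr (1 / p)"
    and chain_rule: "\<And>f (g :: real \<Rightarrow> real) L. \<lbrakk>f \<in> F; L-lipschitz_on UNIV g; g 0 = 0\<rbrakk> \<Longrightarrow>
      (\<lambda>x. g (f x)) \<in> F \<and>
      measure_le (\<Gamma> (\<lambda>x. g (f x))) (density (\<Gamma> f) (\<lambda>x. ennreal (Lip_a g (f x) powr p)))"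
    and locality: "\<And>f A c. \<lbrakk>f \<in> F; A \<in> sets M; AE x in M. x \<in> A \<longrightarrow> f x = c\<rbrakk> \<Longrightarrow>
      measure (\<Gamma> f) A = 0"
    and lower_semicontinuity: "\<And>f u.
      \<lbrakk>f \<in> Lp_space p M; \<And>i::nat. u i \<in> F;
       (\<lambda>i. Lp_norm p M (\<lambda>x. u i x - f x)) \<longlonglongrightarrow> 0;
       bdd_above (range (\<lambda>i. E (u i)))\<rbrakk> \<Longrightarrow>
      f \<in> F \<and> (\<forall>A\<in>sets M. emeasure (\<Gamma> f) A \<le> liminf (\<lambda>i. emeasure (\<Gamma> (u i)) A))"

end

theory Submission
  imports Defs
begin

text \<open>
  Let \<open>g\<close> be \<open>L\<close>-Lipschitz. For affine \<open>g\<close> the bound, with \<open>L\<close> in place of the pointwise constant,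
  is the triangle inequality for \<open>\<Gamma>\<close> followed by Cauchy--Schwarz and the comparison of power sums,
  and by locality it passes to maxima and minima. Through any two points of the graph of \<open>g\<close> passes
  the graph of an affine function of slope at most \<open>L\<close>; if \<open>\<ell>\<^sub>y\<^sub>z\<close> is one for \<open>y, z\<close> in a finite set
  \<open>Z\<close>, then \<open>min\<^sub>y max\<^sub>z \<ell>\<^sub>y\<^sub>z\<close> agrees with \<open>g\<close> on \<open>Z\<close>. Letting \<open>Z\<close> exhaust a countable dense set,
  lower semicontinuity gives the bound for \<open>g\<close>. Where the pointwise constant is less than \<open>c\<close>, \<open>g\<close> agrees
  locally with a \<open>c\<close>-Lipschitz extension of its restriction to a ball, so by locality the bound
  holds there with \<open>c\<close>. Summing over thin level sets of the pointwise constant gives the theorem.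
\<close>

subsection \<open>Power sums\<close>

lemma convex_on_powr_nonneg:
  fixes q :: real
  assumes "1 \<le> q"
  shows "convex_on {0..} (\<lambda>x. x powr q)"
proof (rule convex_onI)
  fix t x y :: real
  assume t: "0 < t" "t < 1" and "x \<in> {0..}" "y \<in> {0..}"
  have scale: "(s * z) powr q \<le> s * z powr q" if "0 < s" "s < 1" "0 \<le> z" for s z :: real
  proof -
    have "s powr q \<le> s"
      using powr_mono'[OF assms, of s] that by simp
    then show ?thesis
      using that by (simp add: powr_mult mult_right_mono)
  qed
  consider "x = 0" | "y = 0" | "0 < x" "0 < y"
    using \<open>x \<in> {0..}\<close> \<open>y \<in> {0..}\<close> by force
  then show "((1 - t) *\<^sub>R x + t *\<^sub>R y) powr q \<le> (1 - t) * x powr q + t * y powr q"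
  proof cases
    case 3
    then show ?thesis
      using convex_onD[OF powr_convex[OF assms], of t x y] t by simp
  qed (use scale t \<open>x \<in> {0..}\<close> \<open>y \<in> {0..}\<close> in auto)
qed simp

lemma powr_sum_le_card_mult_sum_powr:
  fixes y :: "'i \<Rightarrow> real"
  assumes "finite I" and "\<And>i. i \<in> I \<Longrightarrow> 0 \<le> y i" and "1 \<le> q"
  shows "(\<Sum>i\<in>I. y i) powr q \<le> real (card I) powr (q - 1) * (\<Sum>i\<in>I. y i powr q)"
proof (cases "I = {}")
  case False
  define m where "m = real (card I)"
  have m: "0 < m"
    using False assms by (simp add: m_def card_gt_0_iff)
  have "(\<Sum>i\<in>I. (1 / m) *\<^sub>R y i) powr q \<le> (\<Sum>i\<in>I. 1 / m * y i powr q)"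
    using assms m False by (intro convex_on_sum[OF _ _ convex_on_powr_nonneg]) (auto simp: m_def)
  then have "((\<Sum>i\<in>I. y i) / m) powr q \<le> (\<Sum>i\<in>I. y i powr q) / m"
    by (simp add: sum_divide_distrib)
  then have "(\<Sum>i\<in>I. y i) powr q / m powr q \<le> (\<Sum>i\<in>I. y i powr q) / m"
    using assms m by (simp add: powr_divide sum_nonneg)
  then show ?thesis
    using m by (simp add: m_def[symmetric] powr_diff field_simps)
qed simp

lemma powr_sum_le_sum_powr:
  fixes y :: "'i \<Rightarrow> real"
  assumes "finite I" and nonneg: "\<And>i. i \<in> I \<Longrightarrow> 0 \<le> y i" and "0 < q" and "q \<le> 1"
  shows "(\<Sum>i\<in>I. y i) powr q \<le> (\<Sum>i\<in>I. y i powr q)"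
proof (cases "(\<Sum>i\<in>I. y i) = 0")
  case True
  then show ?thesis
    by (simp add: sum_nonneg)
next
  case False
  define S where "S = (\<Sum>i\<in>I. y i)"
  have S: "0 < S"
    using False sum_nonneg[of I y] nonneg by (simp add: S_def)
  have ratio_le: "y i / S \<le> y i powr q / S powr q" if "i \<in> I" for i
  proof -
    have "y i \<le> S"
      unfolding S_def using assms that by (intro member_le_sum) auto
    then have "y i / S \<le> (y i / S) powr q"
      using powr_mono'[OF \<open>q \<le> 1\<close>, of "y i / S"] nonneg[OF that] S by simp
    then show ?thesis
      using nonneg[OF that] S by (simp add: powr_divide)
  qed
  have "1 = (\<Sum>i\<in>I. y i / S)"
    using S by (simp add: S_def flip: sum_divide_distrib)
  also have "\<dots> \<le> (\<Sum>i\<in>I. y i powr q / S powr q)"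
    by (intro sum_mono ratio_le)
  finally show ?thesis
    using S by (simp add: S_def flip: sum_divide_distrib)
qed

definition dim_const :: "real \<Rightarrow> nat \<Rightarrow> real" where
  "dim_const p n = max 1 (real n powr ((p - 2) / 2))"

lemma dim_const_ge_1: "1 \<le> dim_const p n"
  by (simp add: dim_const_def)

lemma dim_const_pos: "0 < dim_const p n"
  by (rule less_le_trans[OF zero_less_one dim_const_ge_1])

lemma powr_sum_squares_le:
  fixes x :: "'i \<Rightarrow> real"
  assumes "finite I" and "0 < p" and nonneg: "\<And>i. i \<in> I \<Longrightarrow> 0 \<le> x i"
  shows "(\<Sum>i\<in>I. (x i)\<^sup>2) powr (p / 2) \<le> dim_const p (card I) * (\<Sum>i\<in>I. x i powr p)"
proof -
  have "(\<Sum>i\<in>I. (x i)\<^sup>2) powr (p / 2)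
      \<le> dim_const p (card I) * (\<Sum>i\<in>I. (x i)\<^sup>2 powr (p / 2))"
  proof (cases "p \<le> 2")
    case True
    then have "(\<Sum>i\<in>I. (x i)\<^sup>2) powr (p / 2) \<le> 1 * (\<Sum>i\<in>I. (x i)\<^sup>2 powr (p / 2))"
      using powr_sum_le_sum_powr[of I "\<lambda>i. (x i)\<^sup>2" "p / 2"] assms by simp
    also have "\<dots> \<le> dim_const p (card I) * (\<Sum>i\<in>I. (x i)\<^sup>2 powr (p / 2))"
      by (intro mult_right_mono dim_const_ge_1 sum_nonneg) simp
    finally show ?thesis .
  next
    case False
    then have "(\<Sum>i\<in>I. (x i)\<^sup>2) powr (p / 2)
        \<le> real (card I) powr (p / 2 - 1) * (\<Sum>i\<in>I. (x i)\<^sup>2 powr (p / 2))"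
      using \<open>finite I\<close> by (intro powr_sum_le_card_mult_sum_powr) auto
    also have "\<dots> \<le> dim_const p (card I) * (\<Sum>i\<in>I. (x i)\<^sup>2 powr (p / 2))"
      by (intro mult_right_mono sum_nonneg) (auto simp: dim_const_def diff_divide_distrib)
    finally show ?thesis .
  qed
  moreover have "(x i)\<^sup>2 powr (p / 2) = x i powr p" if "i \<in> I" for i
    using nonneg[OF that] by (cases "x i = 0") (auto simp: powr_powr simp flip: powr_numeral)
  ultimately show ?thesis
    by simp
qed

lemma powr_sum_abs_mult_le:
  fixes a x :: "'i \<Rightarrow> real"
  assumes "finite I" and "0 < p" and nonneg: "\<And>i. i \<in> I \<Longrightarrow> 0 \<le> x i"
  shows "(\<Sum>i\<in>I. \<bar>a i\<bar> * x i) powr p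
    \<le> dim_const p (card I) * L2_set a I powr p * (\<Sum>i\<in>I. x i powr p)"
proof -
  have "(\<Sum>i\<in>I. \<bar>a i\<bar> * x i) \<le> L2_set a I * L2_set x I"
    using L2_set_mult_ineq[of a x I] nonneg by simp
  then have "(\<Sum>i\<in>I. \<bar>a i\<bar> * x i) powr p \<le> (L2_set a I * L2_set x I) powr p"
    using assms by (intro powr_mono2) (auto intro!: sum_nonneg)
  also have "\<dots> = L2_set a I powr p * (\<Sum>i\<in>I. (x i)\<^sup>2) powr (p / 2)"
    by (simp add: powr_mult L2_set_def[of x] powr_half_sqrt[symmetric] sum_nonneg powr_powr)
  also have "\<dots> \<le> L2_set a I powr p * (dim_const p (card I) * (\<Sum>i\<in>I. x i powr p))"
    using assms by (intro mult_left_mono powr_sum_squares_le) auto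
  finally show ?thesis
    by (simp add: mult_ac)
qed

subsection \<open>Lipschitz functions and the pointwise Lipschitz constant\<close>

definition mcshane_extension :: "real \<Rightarrow> 'b set \<Rightarrow> ('b::metric_space \<Rightarrow> real) \<Rightarrow> 'b \<Rightarrow> real" where
  "mcshane_extension L S g y = (INF z\<in>S. g z + L * dist y z)"

context
  fixes g :: "'b::metric_space \<Rightarrow> real" and L :: real and S :: "'b set"
  assumes lipschitz_g: "L-lipschitz_on S g"
begin

lemma lipschitz_on_le_add_dist: "x \<in> S \<Longrightarrow> z \<in> S \<Longrightarrow> g x \<le> g z + L * dist x z"
  using lipschitz_onD[OF lipschitz_g, of x z] by (simp add: dist_real_def)

lemma bdd_below_mcshane: "bdd_below ((\<lambda>z. g z + L * dist y z) ` S)"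
proof (cases "S = {}")
  case False
  then obtain z0 where z0: "z0 \<in> S"
    by auto
  show ?thesis
  proof (rule bdd_belowI2)
    fix z assume "z \<in> S"
    have "L * dist z0 z \<le> L * (dist y z0 + dist y z)"
      using lipschitz_on_nonneg[OF lipschitz_g] by (intro mult_left_mono dist_triangle3)
    with lipschitz_on_le_add_dist[OF z0 \<open>z \<in> S\<close>]
    show "g z0 - L * dist y z0 \<le> g z + L * dist y z"
      by (simp add: algebra_simps)
  qed
qed simp

lemma mcshane_extension_eq: "y \<in> S \<Longrightarrow> mcshane_extension L S g y = g y"
  unfolding mcshane_extension_def
  using cINF_lower[OF bdd_below_mcshane, of y y]
  by (intro antisym cINF_greatest lipschitz_on_le_add_dist) auto

lemma mcshane_extension_lipschitz_on:
  assumes "S \<noteq> {}"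
  shows "L-lipschitz_on UNIV (mcshane_extension L S g)" (is "L-lipschitz_on UNIV ?h")
proof (rule lipschitz_onI)
  show L: "0 \<le> L"
    using lipschitz_g by (rule lipschitz_on_nonneg)
  have h_le: "?h x - L * dist x y \<le> ?h y" for x y
    unfolding mcshane_extension_def[of L S g y]
  proof (rule cINF_greatest)
    fix z assume "z \<in> S"
    then have "?h x \<le> g z + L * dist x z"
      unfolding mcshane_extension_def by (rule cINF_lower[OF bdd_below_mcshane])
    also have "\<dots> \<le> g z + L * (dist x y + dist y z)"
      using L by (intro add_left_mono mult_left_mono dist_triangle)
    finally show "?h x - L * dist x y \<le> g z + L * dist y z"
      by (simp add: algebra_simps)
  qed fact
  show "dist (?h x) (?h y) \<le> L * dist x y" for x y
    using h_le[of x y] h_le[of y x] by (simp add: dist_real_def dist_commute abs_le_iff)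
qed

end

lemma LIP_le: "L-lipschitz_on S g \<Longrightarrow> LIP g S \<le> L"
  unfolding LIP_def by (rule cInf_lower) (auto intro!: bdd_belowI[of _ 0] lipschitz_on_nonneg)

lemma LIP_nonneg: "L-lipschitz_on S g \<Longrightarrow> 0 \<le> LIP g S"
  unfolding LIP_def by (intro cInf_greatest) (auto intro: lipschitz_on_nonneg)

lemma LIP_mono: "L-lipschitz_on T g \<Longrightarrow> S \<subseteq> T \<Longrightarrow> LIP g S \<le> LIP g T"
  unfolding LIP_def
  by (intro cInf_superset_mono)
    (auto intro!: bdd_belowI[of _ 0] lipschitz_on_nonneg elim: lipschitz_on_subset)

lemma lipschitz_on_of_LIP_less: "L-lipschitz_on S g \<Longrightarrow> LIP g S < c \<Longrightarrow> c-lipschitz_on S g"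
  unfolding LIP_def using cInf_lessD[of "{L. L-lipschitz_on S g}" c]
  by (auto intro: lipschitz_on_mono less_imp_le)

context
  fixes g :: "'b::metric_space \<Rightarrow> real" and L :: real
  assumes lipschitz_g: "L-lipschitz_on UNIV g"
begin

lemma lipschitz_on_of_UNIV: "L-lipschitz_on S g"
  using lipschitz_g by (rule lipschitz_on_subset) simp

lemma bdd_below_LIP_ball: "bdd_below ((\<lambda>r. LIP g (ball y r)) ` R)"
  using LIP_nonneg[OF lipschitz_on_of_UNIV] by (rule bdd_belowI2)

lemma Lip_a_eq_INF: "Lip_a g y = (INF r\<in>{0<..}. LIP g (ball y r))"
proof -
  define l where "l = (INF r\<in>{0<..}. LIP g (ball y r))"
  have "((\<lambda>r. LIP g (ball y r)) \<longlongrightarrow> l) (at_right 0)"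
  proof (rule order_tendstoI)
    fix a assume "a < l"
    moreover have "l \<le> LIP g (ball y r)" if "0 < r" for r
      unfolding l_def using that by (intro cINF_lower[OF bdd_below_LIP_ball]) auto
    ultimately show "\<forall>\<^sub>F r in at_right 0. a < LIP g (ball y r)"
      unfolding eventually_at_right_field by (intro exI[of _ 1]) force
  next
    fix a assume "l < a"
    then obtain s where s: "0 < s" "LIP g (ball y s) < a"
      unfolding l_def by (subst (asm) cINF_less_iff[OF _ bdd_below_LIP_ball]) auto
    have "LIP g (ball y r) < a" if "r < s" for r
      using LIP_mono[OF lipschitz_on_of_UNIV subset_ball[of r s y]] s that by linarith
    then show "\<forall>\<^sub>F r in at_right 0. LIP g (ball y r) < a"
      unfolding eventually_at_right_field using s by blast
  qed
  then show ?thesis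
    unfolding Lip_a_def l_def by (simp add: tendsto_Lim)
qed

lemma Lip_a_le: "0 < r \<Longrightarrow> c-lipschitz_on (ball y r) g \<Longrightarrow> Lip_a g y \<le> c"
  unfolding Lip_a_eq_INF
  by (rule order_trans[OF cINF_lower[OF bdd_below_LIP_ball, of r] LIP_le]) auto

lemma lipschitz_on_ball_of_Lip_a_less:
  assumes "Lip_a g y < c"
  obtains r where "0 < r" and "c-lipschitz_on (ball y r) g"
proof -
  obtain r where "0 < r" "LIP g (ball y r) < c"
    using assms unfolding Lip_a_eq_INF by (subst (asm) cINF_less_iff[OF _ bdd_below_LIP_ball]) auto
  then show thesis
    using lipschitz_on_of_LIP_less[OF lipschitz_on_of_UNIV] that by blast
qed

lemma open_Lip_a_less: "open {y. Lip_a g y < c}"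
  unfolding open_contains_ball
proof safe
  fix y assume "Lip_a g y < c"
  then obtain d where d: "Lip_a g y < d" "d < c"
    using dense by blast
  obtain r where r: "0 < r" "d-lipschitz_on (ball y r) g"
    using lipschitz_on_ball_of_Lip_a_less[OF d(1)] .
  have "Lip_a g z < c" if z: "z \<in> ball y r" for z
  proof -
    obtain s where "0 < s" "ball z s \<subseteq> ball y r"
      using openE[OF open_ball z] by blast
    then have "Lip_a g z \<le> d"
      using Lip_a_le lipschitz_on_subset[OF r(2)] by blast
    with d show ?thesis by simp
  qed
  with r show "\<exists>r>0. ball y r \<subseteq> {y. Lip_a g y < c}"
    by auto
qed

lemma borel_measurable_Lip_a: "Lip_a g \<in> borel_measurable borel"
  by (rule borel_measurableI_less) (simp add: open_Lip_a_less)

end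

lemma countable_lipschitz_cover:
  fixes g :: "'b::{metric_space, second_countable_topology} \<Rightarrow> real"
  assumes "L-lipschitz_on UNIV g"
  obtains \<U> where "countable \<U>" and "{y. Lip_a g y < c} \<subseteq> \<Union>\<U>"
    and "\<And>U. U \<in> \<U> \<Longrightarrow> open U \<and> U \<noteq> {} \<and> c-lipschitz_on U g"
proof -
  define \<V> where "\<V> = {U. open U \<and> U \<noteq> {} \<and> c-lipschitz_on U g}"
  obtain \<U> where \<U>: "\<U> \<subseteq> \<V>" "countable \<U>" "\<Union>\<U> = \<Union>\<V>"
    using Lindelof[of \<V>] by (auto simp: \<V>_def)
  have "y \<in> \<Union>\<V>" if less: "Lip_a g y < c" for y
  proof -
    obtain r where "0 < r" "c-lipschitz_on (ball y r) g"
      using lipschitz_on_ball_of_Lip_a_less[OF assms less] .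
    then have "ball y r \<in> \<V>" "y \<in> ball y r"
      by (auto simp: \<V>_def)
    then show ?thesis
      by blast
  qed
  with \<U> show thesis
    by (intro that[of \<U>]) (auto simp: \<V>_def)
qed

subsection \<open>Interpolation by maxima and minima of affine functions\<close>

inductive max_min_affine :: "real \<Rightarrow> ('b::real_inner \<Rightarrow> real) \<Rightarrow> bool" for L where
  affine: "norm a \<le> L \<Longrightarrow> max_min_affine L (\<lambda>y. c + a \<bullet> y)"
| max: "max_min_affine L g \<Longrightarrow> max_min_affine L h \<Longrightarrow> max_min_affine L (\<lambda>y. max (g y) (h y))"
| min: "max_min_affine L g \<Longrightarrow> max_min_affine L h \<Longrightarrow> max_min_affine L (\<lambda>y. min (g y) (h y))"

lemma max_min_affine_Max:
  assumes "finite I" and "I \<noteq> {}" and "\<And>i. i \<in> I \<Longrightarrow> max_min_affine L (g i)"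
  shows "max_min_affine L (\<lambda>y. Max ((\<lambda>i. g i y) ` I))"
  using assms by (induction I rule: finite_ne_induct) (auto intro: max_min_affine.max)

lemma max_min_affine_Min:
  assumes "finite I" and "I \<noteq> {}" and "\<And>i. i \<in> I \<Longrightarrow> max_min_affine L (g i)"
  shows "max_min_affine L (\<lambda>y. Min ((\<lambda>i. g i y) ` I))"
  using assms by (induction I rule: finite_ne_induct) (auto intro: max_min_affine.min)

lemma max_min_affine_lipschitz_on:
  assumes "max_min_affine L g"
  shows "L-lipschitz_on S g"
  using assms
proof (induction rule: max_min_affine.induct)
  case (affine a c)
  have "\<bar>a \<bullet> (x - y)\<bar> \<le> L * norm (x - y)" for x y
    using Cauchy_Schwarz_ineq2[of a "x - y"] mult_right_mono[OF affine, of "norm (x - y)"] by simp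
  then show ?case
    using order_trans[OF norm_ge_zero affine]
    by (intro lipschitz_onI) (simp_all add: dist_real_def dist_norm inner_diff_right)
next
  case (max g h)
  show ?case
  proof (rule lipschitz_onI)
    fix x y assume "x \<in> S" "y \<in> S"
    with max.IH[THEN lipschitz_onD, of x y]
    show "dist (max (g x) (h x)) (max (g y) (h y)) \<le> L * dist x y"
      unfolding dist_real_def by linarith
  qed (rule lipschitz_on_nonneg[OF max.IH(1)])
next
  case (min g h)
  show ?case
  proof (rule lipschitz_onI)
    fix x y assume "x \<in> S" "y \<in> S"
    with min.IH[THEN lipschitz_onD, of x y]
    show "dist (min (g x) (h x)) (min (g y) (h y)) \<le> L * dist x y"
      unfolding dist_real_def by linarith
  qed (rule lipschitz_on_nonneg[OF min.IH(1)])
qed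

lemma affine_interpolation_two_points:
  fixes y z :: "'b::real_inner"
  assumes "0 \<le> L" and "\<bar>s - t\<bar> \<le> L * norm (y - z)"
  obtains c :: real and a :: 'b where "norm a \<le> L" and "c + a \<bullet> y = s" and "c + a \<bullet> z = t"
proof (cases "y = z")
  case True
  then show thesis
    using assms that[of 0 s] by simp
next
  case False
  define a where "a = ((s - t) / (norm (y - z))\<^sup>2) *\<^sub>R (y - z)"
  have "norm a = \<bar>s - t\<bar> / norm (y - z)"
    using False by (simp add: a_def power2_eq_square)
  also have "\<dots> \<le> L"
    using False assms by (simp add: divide_le_eq)
  finally have "norm a \<le> L" .
  moreover have "a \<bullet> (y - z) = s - t"
    using False by (simp add: a_def dot_square_norm)
  ultimately show thesis
    using that[of a "t - a \<bullet> z"] by (simp add: inner_diff_right)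
qed

lemma max_min_affine_interpolation:
  fixes g :: "'b::real_inner \<Rightarrow> real"
  assumes g: "L-lipschitz_on Z g" and "finite Z"
  obtains h where "max_min_affine L h" and "\<And>z. z \<in> Z \<Longrightarrow> h z = g z"
proof (cases "Z = {}")
  case True
  have "max_min_affine L (\<lambda>y::'b. 0 + 0 \<bullet> y)"
    using lipschitz_on_nonneg[OF g] by (intro max_min_affine.affine) simp
  with True show thesis
    by (intro that) auto
next
  case False
  have "\<exists>c a. norm a \<le> L \<and> c + a \<bullet> y = g y \<and> c + a \<bullet> z = g z" if "y \<in> Z" "z \<in> Z" for y z
    using affine_interpolation_two_points[OF lipschitz_on_nonneg[OF g], of "g y" "g z" y z]
      lipschitz_onD[OF g that] unfolding dist_real_def dist_norm by metis
  then obtain c a where a: "\<And>y z. y \<in> Z \<Longrightarrow> z \<in> Z \<Longrightarrow> norm (a y z) \<le> L"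
    and interp: "\<And>y z. y \<in> Z \<Longrightarrow> z \<in> Z \<Longrightarrow> c y z + a y z \<bullet> y = g y \<and> c y z + a y z \<bullet> z = g z"
    by metis
  define M where "M y x = Max ((\<lambda>z. c y z + a y z \<bullet> x) ` Z)" for y x
  have M_ge: "g x \<le> M y x" if "x \<in> Z" "y \<in> Z" for x y
    unfolding M_def using interp[of y x] that \<open>finite Z\<close> by (intro Max_ge) force+
  have M_self: "M y y = g y" if "y \<in> Z" for y
    unfolding M_def using interp[OF that] that False by (simp add: image_constant_conv)
  show thesis
  proof
    show "max_min_affine L (\<lambda>x. Min ((\<lambda>y. M y x) ` Z))"
      unfolding M_def using \<open>finite Z\<close> False a
      by (intro max_min_affine_Min max_min_affine_Max max_min_affine.affine)
    show "Min ((\<lambda>y. M y x) ` Z) = g x" if "x \<in> Z" for x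
      using M_ge[OF that] M_self[OF that] \<open>finite Z\<close> that by (intro Min_eqI) force+
  qed
qed

lemma lipschitz_tendsto_of_dense:
  fixes g :: "'b::metric_space \<Rightarrow> real"
  assumes g: "L-lipschitz_on UNIV g" and h: "\<And>k. L-lipschitz_on UNIV (h k)"
    and dense: "closure D = UNIV"
    and lim: "\<And>z. z \<in> D \<Longrightarrow> \<forall>\<^sub>F k in F. h k z = g z"
  shows "((\<lambda>k. h k y) \<longlongrightarrow> g y) F"
proof (rule tendstoI)
  fix e :: real assume "0 < e"
  define d where "d = e / (2 * L + 1)"
  have L: "0 \<le> L"
    using g by (rule lipschitz_on_nonneg)
  then have "0 < d"
    using \<open>0 < e\<close> by (simp add: d_def)
  then obtain z where z: "z \<in> D" "dist z y < d"
    using dense closure_approachable[of y D] by auto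
  have "dist (h k y) (g y) < e" if "h k z = g z" for k
  proof -
    have "dist (h k y) (g y) \<le> dist (h k z) (h k y) + dist (g z) (g y)"
      using that by (metis dist_triangle3)
    also have "\<dots> \<le> L * dist z y + L * dist z y"
      using lipschitz_onD[OF h] lipschitz_onD[OF g] by (intro add_mono) auto
    also have "\<dots> \<le> 2 * L * d"
      using mult_left_mono[OF less_imp_le[OF z(2)] L] by simp
    also have "\<dots> < e"
      using \<open>0 < e\<close> L by (simp add: d_def field_simps)
    finally show ?thesis .
  qed
  with lim[OF z(1)] show "\<forall>\<^sub>F k in F. dist (h k y) (g y) < e"
    by (rule eventually_mono)
qed

lemma lipschitz_limit_of_max_min_affine:
  fixes g :: "'b::{real_inner, second_countable_topology} \<Rightarrow> real"
  assumes g: "L-lipschitz_on UNIV g"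
  obtains h where "\<And>k::nat. max_min_affine L (h k)" and "\<And>y. (\<lambda>k. h k y) \<longlonglongrightarrow> g y"
proof -
  obtain D :: "'b set" where D: "countable D" "closure D = UNIV"
    by (rule separable[of "UNIV :: 'b set"]) auto
  define z where "z = from_nat_into D"
  have "D \<noteq> {}"
    using D by auto
  then have z: "range z = D"
    unfolding z_def using D(1) by (rule range_from_nat_into)
  have "L-lipschitz_on (z ` {..k}) g" for k
    using g by (rule lipschitz_on_subset) simp
  then have "\<exists>h. max_min_affine L h \<and> (\<forall>x\<in>z ` {..k}. h x = g x)" for k
    by (metis max_min_affine_interpolation finite_atMost finite_imageI)
  then obtain h where h: "\<And>k. max_min_affine L (h k)" "\<And>k. \<forall>x\<in>z ` {..k}. h k x = g x"
    by metis
  have "\<forall>\<^sub>F k in sequentially. h k x = g x" if x: "x \<in> D" for x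
  proof -
    obtain j where "x = z j"
      using x z by auto
    then show ?thesis
      using h(2) by (auto simp: eventually_sequentially intro!: exI[of _ j])
  qed
  then have "(\<lambda>k. h k y) \<longlonglongrightarrow> g y" for y
    by (intro lipschitz_tendsto_of_dense[OF g max_min_affine_lipschitz_on[OF h(1)] D(2)])
  with h(1) show thesis
    by (rule that)
qed

subsection \<open>Comparison of measures\<close>

lemma emeasure_le_of_countable_cover:
  assumes sets: "sets N' = sets N" and A: "A \<in> sets N"
    and \<B>: "countable \<B>" "\<B> \<subseteq> sets N" "A \<subseteq> \<Union>\<B>"
    and le_on_pieces: "\<And>B D. \<lbrakk>B \<in> \<B>; D \<in> sets N; D \<subseteq> A \<inter> B\<rbrakk> \<Longrightarrow> emeasure N D \<le> emeasure N' D"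
  shows "emeasure N A \<le> emeasure N' A"
proof (cases "\<B> = {}")
  case False
  define B where "B = from_nat_into \<B>"
  have B_in: "B i \<in> \<B>" for i
    unfolding B_def using False by (rule from_nat_into)
  define D where "D i = A \<inter> disjointed B i" for i
  have D_sets: "D i \<in> sets N" for i
    using A \<B>(2) B_in sets.range_disjointed_sets[of B N] by (auto simp: D_def)
  have disj: "disjoint_family D"
    using disjoint_family_disjointed[of B] by (auto simp: D_def disjoint_family_on_def)
  have "range B = \<B>"
    unfolding B_def by (rule range_from_nat_into[OF False \<B>(1)])
  then have A_eq: "A = (\<Union>i. D i)"
    using \<B>(3) by (simp add: D_def UN_disjointed_eq Int_absorb2 flip: Int_UN_distrib)
  have "emeasure N A = (\<Sum>i. emeasure N (D i))"
    unfolding A_eq using D_sets disj by (intro suminf_emeasure[symmetric]) auto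
  also have "\<dots> \<le> (\<Sum>i. emeasure N' (D i))"
  proof (intro suminf_le)
    show "emeasure N (D i) \<le> emeasure N' (D i)" for i
      using le_on_pieces[OF B_in D_sets, of i i] disjointed_subset[of B i] by (auto simp: D_def)
  qed auto
  also have "\<dots> = emeasure N' A"
    unfolding A_eq using D_sets disj sets by (intro suminf_emeasure) auto
  finally show ?thesis .
qed (use \<B> in auto)

lemma nonneg_real_between_multiples:
  fixes t e :: real
  assumes "0 \<le> t" and "0 < e"
  obtains k :: nat where "real k * e \<le> t" and "t < (real k + 1) * e"
proof
  have "0 \<le> t / e"
    using assms by simp
  then have "real (nat \<lfloor>t / e\<rfloor>) \<le> t / e" "t / e < real (nat \<lfloor>t / e\<rfloor>) + 1"
    by linarith+
  with \<open>0 < e\<close> show "real (nat \<lfloor>t / e\<rfloor>) * e \<le> t" "t < (real (nat \<lfloor>t / e\<rfloor>) + 1) * e"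
    by (simp_all add: field_simps)
qed

context
  fixes S N :: "'a measure" and \<phi> :: "'a \<Rightarrow> real"
  assumes sets_N: "sets N = sets S"
    and \<phi>_measurable [measurable]: "\<phi> \<in> borel_measurable S"
    and \<phi>_nonneg: "\<And>x. x \<in> space S \<Longrightarrow> 0 \<le> \<phi> x"
    and le_of_sublevel: "\<And>c A. \<lbrakk>0 < c; A \<in> sets S; \<And>x. x \<in> A \<Longrightarrow> \<phi> x < c\<rbrakk>
      \<Longrightarrow> emeasure N A \<le> ennreal c * emeasure S A"
begin

lemma emeasure_le_density_add_of_band:
  assumes "0 < c" and D [measurable]: "D \<in> sets S"
    and band: "\<And>x. x \<in> D \<Longrightarrow> \<phi> x < c \<and> c \<le> \<phi> x + e"
  shows "emeasure N D \<le> emeasure (density S (\<lambda>x. ennreal (\<phi> x + e))) D"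
proof -
  have "emeasure N D \<le> ennreal c * emeasure S D"
    using band by (intro le_of_sublevel[OF \<open>0 < c\<close> D]) auto
  also have "\<dots> = (\<integral>\<^sup>+x. ennreal c * indicator D x \<partial>S)"
    using D by (rule nn_integral_cmult_indicator[symmetric])
  also have "\<dots> \<le> (\<integral>\<^sup>+x. ennreal (\<phi> x + e) * indicator D x \<partial>S)"
    using band by (intro nn_integral_mono) (auto simp: indicator_def intro!: ennreal_leI)
  also have "\<dots> = emeasure (density S (\<lambda>x. ennreal (\<phi> x + e))) D"
    by (intro emeasure_density[symmetric]) measurable
  finally show ?thesis .
qed

lemma emeasure_le_density_add_of_sublevel:
  assumes A: "A \<in> sets S" and "0 < e"
  shows "emeasure N A \<le> emeasure (density S (\<lambda>x. ennreal (\<phi> x + e))) A"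
proof -
  define band where
    "band k = {x \<in> space S. real k * e \<le> \<phi> x \<and> \<phi> x < (real k + 1) * e}" for k :: nat
  show ?thesis
  proof (rule emeasure_le_of_countable_cover[where \<B> = "range band"])
    have "band k \<in> sets S" for k
      unfolding band_def by measurable
    then show "range band \<subseteq> sets N"
      using sets_N by auto
    show "A \<subseteq> \<Union> (range band)"
    proof
      fix x assume "x \<in> A"
      then have x: "x \<in> space S"
        using sets.sets_into_space[OF A] by auto
      then obtain k where "real k * e \<le> \<phi> x" "\<phi> x < (real k + 1) * e"
        using nonneg_real_between_multiples[OF \<phi>_nonneg \<open>0 < e\<close>] by blast
      with x show "x \<in> \<Union> (range band)"
        by (auto simp: band_def)
    qed
    fix B D assume "B \<in> range band" and D: "D \<in> sets N" "D \<subseteq> A \<inter> B"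
    then obtain k where "D \<subseteq> band k"
      by auto
    with D(1) \<open>0 < e\<close> show "emeasure N D \<le> emeasure (density S (\<lambda>x. ennreal (\<phi> x + e))) D"
      by (intro emeasure_le_density_add_of_band[of "(real k + 1) * e"])
        (auto simp: sets_N band_def algebra_simps intro!: add_pos_nonneg)
  qed (simp_all add: A sets_N)
qed

lemma measure_le_density_of_sublevel:
  assumes "finite_measure S"
  shows "measure_le N (density S (\<lambda>x. ennreal (\<phi> x)))"
proof -
  interpret S: finite_measure S
    by fact
  have "emeasure N A \<le> emeasure (density S (\<lambda>x. ennreal (\<phi> x))) A" if A: "A \<in> sets S" for A
  proof (rule ennreal_le_epsilon)
    fix e :: real assume "0 < e"
    define d where "d = e / (measure S A + 1)"
    have d: "0 < d" "d * measure S A \<le> e"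
      using \<open>0 < e\<close> by (auto simp: d_def field_simps add_pos_nonneg)
    note [measurable] = A
    have "emeasure N A \<le> (\<integral>\<^sup>+x. ennreal (\<phi> x + d) * indicator A x \<partial>S)"
      using emeasure_le_density_add_of_sublevel[OF A d(1)] by (simp add: emeasure_density)
    also have "\<dots> = (\<integral>\<^sup>+x. ennreal (\<phi> x) * indicator A x + ennreal d * indicator A x \<partial>S)"
      using \<phi>_nonneg d by (intro nn_integral_cong) (auto simp: indicator_def)
    also have "\<dots> = emeasure (density S (\<lambda>x. ennreal (\<phi> x))) A + ennreal d * emeasure S A"
      by (simp add: nn_integral_add emeasure_density nn_integral_cmult_indicator)
    also have "ennreal d * emeasure S A \<le> ennreal e"
      using d by (simp add: S.emeasure_eq_measure ennreal_leI flip: ennreal_mult)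
    finally show "emeasure N A \<le> emeasure (density S (\<lambda>x. ennreal (\<phi> x))) A + ennreal e"
      by (simp add: add_left_mono)
  qed
  then show ?thesis
    by (simp add: measure_le_def sets_N)
qed

end

lemma sets_sum_measure [simp]: "sets (sum_measure M I N) = sets M"
  and space_sum_measure [simp]: "space (sum_measure M I N) = space M"
  by (auto simp: sum_measure_def)

lemma emeasure_sum_measure:
  fixes M :: "'a measure"
  assumes "finite I" and "\<And>i. i \<in> I \<Longrightarrow> sets (N i) = sets M" and "A \<in> sets M"
  shows "emeasure (sum_measure M I N) A = (\<Sum>i\<in>I. emeasure (N i) A)"
proof -
  have "countably_additive (sets M) (\<lambda>A. \<Sum>i\<in>I. emeasure (N i) A)"
  proof (rule countably_additiveI)
    fix B :: "nat \<Rightarrow> 'a set" assume "range B \<subseteq> sets M" "disjoint_family B"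
    then have "(\<Sum>i\<in>I. emeasure (N i) (\<Union>k. B k)) = (\<Sum>i\<in>I. \<Sum>k. emeasure (N i) (B k))"
      using assms by (intro sum.cong refl suminf_emeasure[symmetric]) auto
    also have "\<dots> = (\<Sum>k. \<Sum>i\<in>I. emeasure (N i) (B k))"
      by (intro suminf_sum[symmetric]) auto
    finally show "(\<Sum>k. \<Sum>i\<in>I. emeasure (N i) (B k)) = (\<Sum>i\<in>I. emeasure (N i) (\<Union>k. B k))"
      by simp
  qed
  then show ?thesis
    unfolding sum_measure_def using assms
    by (intro emeasure_measure_of_sigma) (auto simp: positive_def sets.sigma_algebra_axioms)
qed

context
  fixes M :: "'a measure" and u :: "nat \<Rightarrow> 'a \<Rightarrow> real" and v w :: "'a \<Rightarrow> real" and p :: real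
  assumes p_pos: "0 < p"
    and u_measurable [measurable]: "\<And>k. u k \<in> borel_measurable M"
    and v_measurable [measurable]: "v \<in> borel_measurable M"
    and w_Lp: "w \<in> Lp_space p M"
    and u_le: "\<And>k. AE x in M. \<bar>u k x\<bar> \<le> w x"
    and u_lim: "AE x in M. (\<lambda>k. u k x) \<longlonglongrightarrow> v x"
begin

lemma dominated_limit_le: "AE x in M. \<bar>v x\<bar> \<le> w x"
proof -
  have "AE x in M. \<forall>k. \<bar>u k x\<bar> \<le> w x"
    using u_le by (simp add: AE_all_countable)
  with u_lim show ?thesis
  proof eventually_elim
    case (elim x)
    from tendsto_rabs[OF elim(1)] show ?case
      by (rule LIMSEQ_le_const2) (use elim(2) in auto)
  qed
qed

lemma dominated_limit_in_Lp_space: "v \<in> Lp_space p M"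
proof -
  have "integrable M (\<lambda>x. \<bar>v x\<bar> powr p)"
  proof (rule Bochner_Integration.integrable_bound)
    show "integrable M (\<lambda>x. \<bar>w x\<bar> powr p)"
      using w_Lp by (simp add: Lp_space_def)
    show "AE x in M. norm (\<bar>v x\<bar> powr p) \<le> norm (\<bar>w x\<bar> powr p)"
      using dominated_limit_le
      by eventually_elim (use p_pos in \<open>auto intro: powr_mono2\<close>)
  qed simp
  then show ?thesis
    by (simp add: Lp_space_def)
qed

lemma tendsto_Lp_norm_dominated: "(\<lambda>k. Lp_norm p M (\<lambda>x. u k x - v x)) \<longlonglongrightarrow> 0"
proof -
  have "(\<lambda>k. LINT x|M. \<bar>u k x - v x\<bar> powr p) \<longlonglongrightarrow> (LINT x|M. 0)"
  proof (rule integral_dominated_convergence[where w = "\<lambda>x. 2 powr p * \<bar>w x\<bar> powr p"])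
    show "integrable M (\<lambda>x. 2 powr p * \<bar>w x\<bar> powr p)"
      using w_Lp by (simp add: Lp_space_def)
    show "AE x in M. (\<lambda>k. \<bar>u k x - v x\<bar> powr p) \<longlonglongrightarrow> 0"
      using u_lim
    proof eventually_elim
      case (elim x)
      then have "(\<lambda>k. \<bar>u k x - v x\<bar>) \<longlonglongrightarrow> 0"
        by (simp add: tendsto_rabs_zero_iff LIM_zero)
      then show ?case
        using p_pos by (intro tendsto_zero_powrI[OF _ tendsto_const]) auto
    qed
    show "AE x in M. norm (\<bar>u k x - v x\<bar> powr p) \<le> 2 powr p * \<bar>w x\<bar> powr p" for k
      using u_le[of k] dominated_limit_le
    proof eventually_elim
      case (elim x)
      then have "\<bar>u k x - v x\<bar> powr p \<le> (2 * \<bar>w x\<bar>) powr p"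
        using p_pos by (intro powr_mono2) auto
      then show ?case
        by (simp add: powr_mult)
    qed
  qed simp_all
  then show ?thesis
    unfolding Lp_norm_def using p_pos by (intro tendsto_zero_powrI[OF _ tendsto_const]) auto
qed

end

subsection \<open>Energy measures\<close>

context p_dirichlet_structure
begin

lemma F_measurable: "u \<in> F \<Longrightarrow> u \<in> borel_measurable M"
  using F_subset_Lp by (auto simp: Lp_space_def)

lemma F_const: "(\<lambda>x. c) \<in> F"
  using F_scale[OF F_one, of c] by simp

lemma F_diff: "u \<in> F \<Longrightarrow> v \<in> F \<Longrightarrow> (\<lambda>x. u x - v x) \<in> F"
  using F_add[of u "\<lambda>x. - 1 * v x"] F_scale[of v "- 1"] by simp

lemma F_sum: "finite I \<Longrightarrow> (\<And>i. i \<in> I \<Longrightarrow> u i \<in> F) \<Longrightarrow> (\<lambda>x. \<Sum>i\<in>I. u i x) \<in> F"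
  by (induction I rule: finite_induct) (auto intro: F_zero F_add)

lemma F_abs: "u \<in> F \<Longrightarrow> (\<lambda>x. \<bar>u x\<bar>) \<in> F"
  using chain_rule[of u 1 abs, OF _ lipschitz_onI] by (simp add: dist_real_def)

lemma F_max:
  assumes "u \<in> F" and "v \<in> F"
  shows "(\<lambda>x. max (u x) (v x)) \<in> F"
proof -
  have "(\<lambda>x. 1 / 2 * ((u x + v x) + \<bar>u x - v x\<bar>)) \<in> F"
    using assms by (intro F_scale F_add F_abs F_diff)
  moreover have "1 / 2 * ((u x + v x) + \<bar>u x - v x\<bar>) = max (u x) (v x)" for x
    by (auto simp: max_def)
  ultimately show ?thesis
    by simp
qed

lemma F_min:
  assumes "u \<in> F" and "v \<in> F"
  shows "(\<lambda>x. min (u x) (v x)) \<in> F"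
proof -
  have "(\<lambda>x. (u x + v x) - max (u x) (v x)) \<in> F"
    using assms by (intro F_add F_diff F_max)
  moreover have "(u x + v x) - max (u x) (v x) = min (u x) (v x)" for x
    by (auto simp: max_def min_def)
  ultimately show ?thesis
    by simp
qed

lemma emeasure_\<Gamma>: "u \<in> F \<Longrightarrow> emeasure (\<Gamma> u) A = ennreal (measure (\<Gamma> u) A)"
  by (simp add: \<Gamma>_finite finite_measure.emeasure_eq_measure)

definition \<Gamma>_le :: "('a \<Rightarrow> real) \<Rightarrow> 'a measure \<Rightarrow> bool" where
  "\<Gamma>_le u N \<longleftrightarrow> u \<in> F \<and> measure_le (\<Gamma> u) N"

lemma \<Gamma>_leI:
  "\<lbrakk>u \<in> F; sets N = sets M; \<And>A. A \<in> sets M \<Longrightarrow> emeasure (\<Gamma> u) A \<le> emeasure N A\<rbrakk> \<Longrightarrow> \<Gamma>_le u N"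
  by (simp add: \<Gamma>_le_def measure_le_def \<Gamma>_sets)

lemma \<Gamma>_le_imp_F: "\<Gamma>_le u N \<Longrightarrow> u \<in> F"
  by (simp add: \<Gamma>_le_def)

lemma \<Gamma>_le_imp_sets: "\<Gamma>_le u N \<Longrightarrow> sets N = sets M"
  by (auto simp: \<Gamma>_le_def measure_le_def \<Gamma>_sets)

lemma \<Gamma>_leD: "\<Gamma>_le u N \<Longrightarrow> A \<in> sets M \<Longrightarrow> emeasure (\<Gamma> u) A \<le> emeasure N A"
  by (auto simp: \<Gamma>_le_def measure_le_def \<Gamma>_sets)

end

locale p_dirichlet_structure_pos = p_dirichlet_structure +
  assumes p_pos: "0 < p"
begin

lemma measure_\<Gamma>_eq_of_diff_const:
  assumes "u \<in> F" and "v \<in> F" and A: "A \<in> sets M"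
    and eq: "AE x in M. x \<in> A \<longrightarrow> u x = v x + c"
  shows "measure (\<Gamma> u) A = measure (\<Gamma> v) A"
proof -
  have one_sided: "measure (\<Gamma> u) A \<le> measure (\<Gamma> v) A"
    if u: "u \<in> F" and v: "v \<in> F" and eq: "AE x in M. x \<in> A \<longrightarrow> u x = v x + c" for u v c
  proof -
    let ?w = "\<lambda>x. u x - v x"
    have w: "?w \<in> F"
      using u v by (rule F_diff)
    have "AE x in M. x \<in> A \<longrightarrow> u x - v x = c"
      using eq by eventually_elim simp
    then have "measure (\<Gamma> ?w) A = 0"
      by (rule locality[OF w A])
    then have "measure (\<Gamma> u) A powr (1 / p) \<le> measure (\<Gamma> v) A powr (1 / p)"
      using \<Gamma>_triangle[OF v w A] by simp
    then show ?thesis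
      using p_pos powr_less_mono2[of "1 / p" "measure (\<Gamma> v) A" "measure (\<Gamma> u) A"]
      by (auto simp: not_less[symmetric])
  qed
  have "AE x in M. x \<in> A \<longrightarrow> v x = u x + (- c)"
    using eq by eventually_elim simp
  with one_sided[OF assms(1,2) eq] one_sided[OF assms(2,1)] show ?thesis
    by (intro antisym)
qed

lemma measure_\<Gamma>_linear_combination_le:
  assumes "finite I" and "\<And>i. i \<in> I \<Longrightarrow> u i \<in> F" and A: "A \<in> sets M"
  shows "measure (\<Gamma> (\<lambda>x. \<Sum>i\<in>I. a i * u i x)) A powr (1 / p)
    \<le> (\<Sum>i\<in>I. \<bar>a i\<bar> * measure (\<Gamma> (u i)) A powr (1 / p))"
  using assms(1,2)
proof (induction I rule: finite_induct)
  case empty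
  have "measure (\<Gamma> (\<lambda>x. 0)) A = 0"
    using F_zero A by (intro locality[of _ _ 0]) auto
  then show ?case
    by simp
next
  case (insert i I)
  have "measure (\<Gamma> (\<lambda>x. a i * u i x)) A = \<bar>a i\<bar> powr p * measure (\<Gamma> (u i)) A"
    using insert by (simp add: \<Gamma>_scale)
  then have "measure (\<Gamma> (\<lambda>x. a i * u i x)) A powr (1 / p)
      = \<bar>a i\<bar> * measure (\<Gamma> (u i)) A powr (1 / p)"
    using p_pos by (simp add: powr_mult powr_powr)
  moreover have "measure (\<Gamma> (\<lambda>x. a i * u i x + (\<Sum>i\<in>I. a i * u i x))) A powr (1 / p)
      \<le> measure (\<Gamma> (\<lambda>x. a i * u i x)) A powr (1 / p)
        + measure (\<Gamma> (\<lambda>x. \<Sum>i\<in>I. a i * u i x)) A powr (1 / p)"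
    using insert A by (intro \<Gamma>_triangle F_scale F_sum) auto
  ultimately show ?case
    using insert by simp
qed

lemma emeasure_\<Gamma>_le_of_countable_pieces:
  assumes w: "w \<in> F" and N: "sets N = sets M" and A: "A \<in> sets M"
    and \<B>: "countable \<B>" "\<B> \<subseteq> sets M" "A \<subseteq> \<Union>\<B>"
    and piece: "\<And>B. B \<in> \<B> \<Longrightarrow> \<exists>u. \<Gamma>_le u N \<and> (\<forall>x\<in>A \<inter> B. w x = u x)"
  shows "emeasure (\<Gamma> w) A \<le> emeasure N A"
proof (rule emeasure_le_of_countable_cover[OF _ _ \<B>(1) _ \<B>(3)])
  fix B D assume B: "B \<in> \<B>" and "D \<in> sets (\<Gamma> w)" and D_sub: "D \<subseteq> A \<inter> B"
  then have D: "D \<in> sets M"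
    using w by (simp add: \<Gamma>_sets)
  obtain u where u: "\<Gamma>_le u N" "\<forall>x\<in>A \<inter> B. w x = u x"
    using piece[OF B] by blast
  have "measure (\<Gamma> w) D = measure (\<Gamma> u) D"
    using u(2) D_sub by (intro measure_\<Gamma>_eq_of_diff_const[OF w \<Gamma>_le_imp_F[OF u(1)] D, of 0]) auto
  then show "emeasure (\<Gamma> w) D \<le> emeasure N D"
    using \<Gamma>_leD[OF u(1) D] by (simp add: emeasure_\<Gamma>[OF w] emeasure_\<Gamma>[OF \<Gamma>_le_imp_F[OF u(1)]])
qed (use w N A \<B>(2) in \<open>auto simp: \<Gamma>_sets\<close>)

lemma \<Gamma>_le_pointwise_choice:
  assumes "w \<in> F" and u: "\<Gamma>_le u N" and v: "\<Gamma>_le v N"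
    and choice: "\<And>x. w x = u x \<or> w x = v x"
  shows "\<Gamma>_le w N"
proof (rule \<Gamma>_leI)
  fix A assume A: "A \<in> sets M"
  have [measurable]: "w \<in> borel_measurable M" "u \<in> borel_measurable M" "v \<in> borel_measurable M"
    using assms by (auto intro: F_measurable \<Gamma>_le_imp_F)
  show "emeasure (\<Gamma> w) A \<le> emeasure N A"
  proof (rule emeasure_\<Gamma>_le_of_countable_pieces[OF \<open>w \<in> F\<close> \<Gamma>_le_imp_sets[OF u] A])
    let ?\<B> = "{{x \<in> space M. w x = u x}, {x \<in> space M. w x = v x}}"
    show "A \<subseteq> \<Union>?\<B>"
      using choice sets.sets_into_space[OF A] by auto
    show "\<exists>u. \<Gamma>_le u N \<and> (\<forall>x\<in>A \<inter> B. w x = u x)" if "B \<in> ?\<B>" for B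
      using that u v by auto
  qed auto
qed (use assms \<Gamma>_le_imp_sets in auto)

lemma \<Gamma>_le_max: "\<Gamma>_le u N \<Longrightarrow> \<Gamma>_le v N \<Longrightarrow> \<Gamma>_le (\<lambda>x. max (u x) (v x)) N"
  by (rule \<Gamma>_le_pointwise_choice[OF F_max, of u v u N v]) (auto intro: \<Gamma>_le_imp_F simp: max_def)

lemma \<Gamma>_le_min: "\<Gamma>_le u N \<Longrightarrow> \<Gamma>_le v N \<Longrightarrow> \<Gamma>_le (\<lambda>x. min (u x) (v x)) N"
  by (rule \<Gamma>_le_pointwise_choice[OF F_min, of u v u N v]) (auto intro: \<Gamma>_le_imp_F simp: min_def)

lemma \<Gamma>_le_dominated_limit:
  fixes u :: "nat \<Rightarrow> 'a \<Rightarrow> real"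
  assumes u: "\<And>k. \<Gamma>_le (u k) N" and N: "finite_measure N"
    and w: "w \<in> Lp_space p M" "\<And>k. AE x in M. \<bar>u k x\<bar> \<le> w x"
    and v: "v \<in> borel_measurable M" "AE x in M. (\<lambda>k. u k x) \<longlonglongrightarrow> v x"
  shows "\<Gamma>_le v N"
proof -
  interpret N: finite_measure N
    by (rule N)
  have uF: "u k \<in> F" for k
    using u by (rule \<Gamma>_le_imp_F)
  note dominated = p_pos F_measurable[OF uF] v(1) w v(2)
  have "E (u k) \<le> measure N (space M)" for k
    using \<Gamma>_leD[OF u sets.top, of k]
    by (simp add: emeasure_\<Gamma>[OF uF] \<Gamma>_total[OF uF] N.emeasure_eq_measure)
  then have "bdd_above (range (\<lambda>k. E (u k)))"
    by (rule bdd_aboveI2)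
  from lower_semicontinuity[OF dominated_limit_in_Lp_space[OF dominated] uF
      tendsto_Lp_norm_dominated[OF dominated] this]
  have vF: "v \<in> F"
    and le_liminf: "\<And>A. A \<in> sets M \<Longrightarrow> emeasure (\<Gamma> v) A \<le> liminf (\<lambda>k. emeasure (\<Gamma> (u k)) A)"
    by auto
  show ?thesis
  proof (rule \<Gamma>_leI[OF vF \<Gamma>_le_imp_sets[OF u]])
    fix A assume A: "A \<in> sets M"
    have "liminf (\<lambda>k. emeasure (\<Gamma> (u k)) A) \<le> emeasure N A"
      by (intro Liminf_le always_eventually allI \<Gamma>_leD[OF u A]) simp
    with le_liminf[OF A] show "emeasure (\<Gamma> v) A \<le> emeasure N A"
      by (rule order_trans)
  qed
qed

end

locale p_dirichlet_tuple = p_dirichlet_structure_pos p M E F \<Gamma>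
  for p :: real and M :: "'a measure" and E F \<Gamma> +
  fixes f :: "'n::finite \<Rightarrow> 'a \<Rightarrow> real"
  assumes f_in_F: "\<And>i. f i \<in> F"
begin

definition fvec :: "'a \<Rightarrow> real ^ 'n" where
  "fvec x = (\<chi> i. f i x)"

definition sum_\<Gamma> :: "'a measure" where
  "sum_\<Gamma> = sum_measure M UNIV (\<lambda>i. \<Gamma> (f i))"

definition lipschitz_bound :: "real \<Rightarrow> 'a measure" where
  "lipschitz_bound L = scale_measure (ennreal (dim_const p CARD('n) * L powr p)) sum_\<Gamma>"

lemma fvec_measurable [measurable]: "fvec \<in> borel_measurable M"
  unfolding fvec_def borel_measurable_euclidean_space[of "\<lambda>x. \<chi> i. f i x"]
  using F_measurable[OF f_in_F] by (auto simp: Basis_vec_def inner_axis)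

lemma sets_sum_\<Gamma> [simp, measurable_cong]: "sets sum_\<Gamma> = sets M"
  and space_sum_\<Gamma> [simp]: "space sum_\<Gamma> = space M"
  by (simp_all add: sum_\<Gamma>_def)

lemma emeasure_sum_\<Gamma>:
  "A \<in> sets M \<Longrightarrow> emeasure sum_\<Gamma> A = ennreal (\<Sum>i\<in>UNIV. measure (\<Gamma> (f i)) A)"
  unfolding sum_\<Gamma>_def
  by (subst emeasure_sum_measure) (auto simp: \<Gamma>_sets f_in_F emeasure_\<Gamma> sum_ennreal)

lemma finite_measure_sum_\<Gamma>: "finite_measure sum_\<Gamma>"
  by (rule finite_measureI) (simp add: emeasure_sum_\<Gamma>)

lemma finite_measure_lipschitz_bound: "finite_measure (lipschitz_bound L)"
  by (rule finite_measureI)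
    (simp add: lipschitz_bound_def space_scale_measure emeasure_sum_\<Gamma> ennreal_mult_eq_top_iff)

lemma sets_lipschitz_bound [simp]: "sets (lipschitz_bound L) = sets M"
  by (simp add: lipschitz_bound_def)

lemma measure_\<Gamma>_inner_le:
  assumes A: "A \<in> sets M"
  shows "measure (\<Gamma> (\<lambda>x. \<Sum>i\<in>UNIV. a $ i * f i x)) A
    \<le> dim_const p CARD('n) * norm a powr p * (\<Sum>i\<in>UNIV. measure (\<Gamma> (f i)) A)"
proof -
  define m where "m i = measure (\<Gamma> (f i)) A powr (1 / p)" for i
  have m: "0 \<le> m i" "m i powr p = measure (\<Gamma> (f i)) A" for i
    using p_pos by (auto simp: m_def powr_powr)
  have "(measure (\<Gamma> (\<lambda>x. \<Sum>i\<in>UNIV. a $ i * f i x)) A powr (1 / p)) powr p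
      \<le> (\<Sum>i\<in>UNIV. \<bar>a $ i\<bar> * m i) powr p"
    unfolding m_def using A f_in_F p_pos by (intro powr_mono2 measure_\<Gamma>_linear_combination_le) auto
  also have "\<dots> \<le> dim_const p CARD('n) * norm a powr p * (\<Sum>i\<in>UNIV. m i powr p)"
    using powr_sum_abs_mult_le[of UNIV p m "($) a"] p_pos m(1) by (simp add: norm_vec_def L2_set_def)
  finally show ?thesis
    using p_pos by (simp add: powr_powr m)
qed

lemma \<Gamma>_le_affine:
  assumes "norm a \<le> L"
  shows "\<Gamma>_le (\<lambda>x. c + a \<bullet> fvec x) (lipschitz_bound L)"
proof -
  let ?l = "\<lambda>x. \<Sum>i\<in>UNIV. a $ i * f i x"
  have l: "?l \<in> F"
    using f_in_F by (intro F_sum F_scale) auto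
  then have cl: "(\<lambda>x. c + ?l x) \<in> F"
    by (intro F_add F_const)
  have "\<Gamma>_le (\<lambda>x. c + ?l x) (lipschitz_bound L)"
  proof (rule \<Gamma>_leI[OF cl])
    fix A assume A: "A \<in> sets M"
    have "measure (\<Gamma> (\<lambda>x. c + ?l x)) A = measure (\<Gamma> ?l) A"
      by (rule measure_\<Gamma>_eq_of_diff_const[OF cl l A, of c]) simp
    also have "\<dots> \<le> dim_const p CARD('n) * norm a powr p * (\<Sum>i\<in>UNIV. measure (\<Gamma> (f i)) A)"
      using A by (rule measure_\<Gamma>_inner_le)
    also have "\<dots> \<le> dim_const p CARD('n) * L powr p * (\<Sum>i\<in>UNIV. measure (\<Gamma> (f i)) A)"
      using assms p_pos less_imp_le[OF dim_const_pos]
      by (intro mult_right_mono mult_left_mono powr_mono2 sum_nonneg) auto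
    finally show "emeasure (\<Gamma> (\<lambda>x. c + ?l x)) A \<le> emeasure (lipschitz_bound L) A"
      using A less_imp_le[OF dim_const_pos]
      by (simp add: emeasure_\<Gamma>[OF cl] lipschitz_bound_def emeasure_sum_\<Gamma> ennreal_leI sum_nonneg
          flip: ennreal_mult)
  qed simp
  then show ?thesis
    by (simp add: inner_vec_def fvec_def)
qed

lemma \<Gamma>_le_max_min_affine:
  "max_min_affine L g \<Longrightarrow> \<Gamma>_le (\<lambda>x. g (fvec x)) (lipschitz_bound L)"
  by (induction rule: max_min_affine.induct) (simp_all add: \<Gamma>_le_affine \<Gamma>_le_max \<Gamma>_le_min)

lemma \<Gamma>_le_lipschitz_limit:
  fixes h :: "nat \<Rightarrow> real ^ 'n \<Rightarrow> real"
  assumes h_le: "\<And>k. \<Gamma>_le (\<lambda>x. h k (fvec x)) N" and N: "finite_measure N"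
    and h_lip: "\<And>k. L-lipschitz_on UNIV (h k)" and lim: "\<And>y. (\<lambda>k. h k y) \<longlonglongrightarrow> g y"
  shows "\<Gamma>_le (\<lambda>x. g (fvec x)) N"
proof -
  have L: "0 \<le> L"
    using h_lip by (rule lipschitz_on_nonneg)
  obtain b where b: "\<bar>h k 0\<bar> \<le> b" for k
    using convergent_imp_Bseq[OF convergentI[OF lim[of 0]]] by (auto simp: Bseq_def)
  define w where "w x = b + L * (\<Sum>i\<in>UNIV. \<bar>f i x\<bar>)" for x
  show ?thesis
  proof (rule \<Gamma>_le_dominated_limit[OF h_le N])
    have "w \<in> F"
      unfolding w_def[abs_def] by (intro F_add F_const F_scale F_sum F_abs f_in_F) auto
    then show "w \<in> Lp_space p M"
      using F_subset_Lp by auto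
    have "\<bar>h k (fvec x)\<bar> \<le> w x" for k x
    proof -
      have "\<bar>h k (fvec x)\<bar> \<le> \<bar>h k 0\<bar> + L * norm (fvec x)"
        using lipschitz_onD[OF h_lip, of "fvec x" 0 k] by (simp add: dist_real_def)
      also have "\<dots> \<le> b + L * (\<Sum>i\<in>UNIV. \<bar>f i x\<bar>)"
        using b L norm_le_l1_cart[of "fvec x"] by (intro add_mono mult_left_mono) (auto simp: fvec_def)
      finally show ?thesis
        by (simp add: w_def)
    qed
    then show "AE x in M. \<bar>h k (fvec x)\<bar> \<le> w x" for k
      by simp
    show "(\<lambda>x. g (fvec x)) \<in> borel_measurable M"
      by (rule borel_measurable_LIMSEQ_real[OF lim F_measurable[OF \<Gamma>_le_imp_F[OF h_le]]])
    show "AE x in M. (\<lambda>k. h k (fvec x)) \<longlonglongrightarrow> g (fvec x)"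
      by (simp add: lim)
  qed
qed

lemma \<Gamma>_le_lipschitz:
  assumes g: "L-lipschitz_on UNIV g"
  shows "\<Gamma>_le (\<lambda>x. g (fvec x)) (lipschitz_bound L)"
proof -
  obtain h where h: "\<And>k::nat. max_min_affine L (h k)" "\<And>y. (\<lambda>k. h k y) \<longlonglongrightarrow> g y"
    using lipschitz_limit_of_max_min_affine[OF g] by blast
  show ?thesis
    by (rule \<Gamma>_le_lipschitz_limit[OF \<Gamma>_le_max_min_affine[OF h(1)] finite_measure_lipschitz_bound
          max_min_affine_lipschitz_on[OF h(1)] h(2)])
qed

lemma emeasure_\<Gamma>_le_of_Lip_a_less:
  fixes g :: "real ^ 'n \<Rightarrow> real"
  assumes g: "L-lipschitz_on UNIV g" and A: "A \<in> sets M"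
    and Lip_a_less: "\<And>x. x \<in> A \<Longrightarrow> Lip_a g (fvec x) < c"
  shows "emeasure (\<Gamma> (\<lambda>x. g (fvec x))) A \<le> emeasure (lipschitz_bound c) A"
proof -
  obtain \<U> where \<U>: "countable \<U>" "{y. Lip_a g y < c} \<subseteq> \<Union>\<U>"
    "\<And>U. U \<in> \<U> \<Longrightarrow> open U \<and> U \<noteq> {} \<and> c-lipschitz_on U g"
    using countable_lipschitz_cover[OF g] by metis
  show ?thesis
  proof (rule emeasure_\<Gamma>_le_of_countable_pieces
      [OF \<Gamma>_le_imp_F[OF \<Gamma>_le_lipschitz[OF g]] sets_lipschitz_bound A])
    let ?\<B> = "(\<lambda>U. fvec -` U \<inter> space M) ` \<U>"
    show "countable ?\<B>"
      using \<U>(1) by simp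
    show "?\<B> \<subseteq> sets M"
      using \<U>(3) by (auto intro!: measurable_sets[OF fvec_measurable])
    show "A \<subseteq> \<Union>?\<B>"
      using Lip_a_less \<U>(2) sets.sets_into_space[OF A] by fastforce
    fix B assume "B \<in> ?\<B>"
    then obtain U where B: "B = fvec -` U \<inter> space M" and U: "U \<noteq> {}" "c-lipschitz_on U g"
      using \<U>(3) by blast
    define h where "h = mcshane_extension c U g"
    have "c-lipschitz_on UNIV h" and "\<And>y. y \<in> U \<Longrightarrow> h y = g y"
      unfolding h_def using U
      by (auto intro: mcshane_extension_lipschitz_on mcshane_extension_eq)
    then show "\<exists>u. \<Gamma>_le u (lipschitz_bound c) \<and> (\<forall>x\<in>A \<inter> B. g (fvec x) = u x)"
      using B by (intro exI[of _ "\<lambda>x. h (fvec x)"]) (auto intro: \<Gamma>_le_lipschitz)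
  qed
qed

lemma chain_rule_vec:
  fixes g :: "real ^ 'n \<Rightarrow> real"
  assumes g: "L-lipschitz_on UNIV g"
  shows "\<Gamma>_le (\<lambda>x. g (fvec x))
    (density sum_\<Gamma> (\<lambda>x. ennreal (dim_const p CARD('n) * Lip_a g (fvec x) powr p)))"
  unfolding \<Gamma>_le_def
proof
  let ?C = "dim_const p CARD('n)"
  have C: "0 < ?C"
    by (rule dim_const_pos)
  have [measurable]: "Lip_a g \<in> borel_measurable borel"
    using g by (rule borel_measurable_Lip_a)
  show gF: "(\<lambda>x. g (fvec x)) \<in> F"
    by (rule \<Gamma>_le_imp_F[OF \<Gamma>_le_lipschitz[OF g]])
  show "measure_le (\<Gamma> (\<lambda>x. g (fvec x)))
    (density sum_\<Gamma> (\<lambda>x. ennreal (?C * Lip_a g (fvec x) powr p)))"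
  proof (rule measure_le_density_of_sublevel[OF _ _ _ _ finite_measure_sum_\<Gamma>])
    fix c A assume "0 < c" and A: "A \<in> sets sum_\<Gamma>"
      and sublevel: "\<And>x. x \<in> A \<Longrightarrow> ?C * Lip_a g (fvec x) powr p < c"
    define d where "d = (c / ?C) powr (1 / p)"
    have d: "?C * d powr p = c"
      using \<open>0 < c\<close> C p_pos by (simp add: d_def powr_powr)
    have "Lip_a g (fvec x) < d" if "x \<in> A" for x
    proof (rule ccontr)
      assume "\<not> Lip_a g (fvec x) < d"
      then have "?C * d powr p \<le> ?C * Lip_a g (fvec x) powr p"
        using C p_pos by (intro mult_left_mono powr_mono2) (auto simp: d_def)
      with sublevel[OF that] d show False
        by simp
    qed
    then have "emeasure (\<Gamma> (\<lambda>x. g (fvec x))) A \<le> emeasure (lipschitz_bound d) A"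
      using A by (intro emeasure_\<Gamma>_le_of_Lip_a_less[OF g]) auto
    then show "emeasure (\<Gamma> (\<lambda>x. g (fvec x))) A \<le> ennreal c * emeasure sum_\<Gamma> A"
      by (simp add: lipschitz_bound_def d)
  qed (use C in \<open>simp_all add: \<Gamma>_sets[OF gF]\<close>)
qed

end

theorem proposition2p61:
  fixes p :: real
    and M :: "'a measure"
    and E :: "('a \<Rightarrow> real) \<Rightarrow> real"
    and F :: "('a \<Rightarrow> real) set"
    and \<Gamma> :: "('a \<Rightarrow> real) \<Rightarrow> 'a measure"
    and g :: "real ^ 'n \<Rightarrow> real"
    and f :: "'n \<Rightarrow> 'a \<Rightarrow> real"
  assumes "1 < p"
    and "p_dirichlet_structure p M E F \<Gamma>"
    and "\<exists>L. L-lipschitz_on UNIV g"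
    and "g 0 = 0"
    and "\<And>i. f i \<in> F"
  shows "(\<lambda>x. g (\<chi> i. f i x)) \<in> F \<and>
    measure_le (\<Gamma> (\<lambda>x. g (\<chi> i. f i x)))
      (density (sum_measure M UNIV (\<lambda>i. \<Gamma> (f i)))
        (\<lambda>x. ennreal (max 1 (real CARD('n) powr ((p - 2) / 2))
                       * Lip_a g (\<chi> i. f i x) powr p)))"
proof -
  interpret p_dirichlet_structure p M E F \<Gamma>
    by fact
  interpret p_dirichlet_tuple p M E F \<Gamma> f
    using assms by unfold_locales auto
  obtain L where "L-lipschitz_on UNIV g"
    using assms by blast
  from chain_rule_vec[OF this] show ?thesis
    unfolding \<Gamma>_le_def sum_\<Gamma>_def dim_const_def fvec_def .
qed

end
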